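(* Let $X$ be a Banach space. The following assertions are equivalent: (1) $X$ has the Schur property. (2) $X$ has the Dunford-Pettis property and every dual map $T : X \to X^*$ is sequentially $w$-$w$ continuous at $0$. (3) $X$ has the Dunford-Pettis property and there exists a dual map $T : X \to X^*$ that is sequentially $w$-$w$ continuous at $0$.
   Context: Banach spaces are over $\mathbb{R}$ or $\mathbb{C}$, and $X^*$ is the (continuous) dual. $X$ has the Schur property if for every sequence $(x_n)$ in $X$ converging weakly to $0$ one has $\|x_n\| \to 0$. $X$ has the Dunford-Pettis property if for every sequence $(x_n)$ in $X$ converging weakly to $0$ and every sequence $(x_n^* )$ in $X^*$ converging to $0$ in the weak topology of $X^*$ (that is, $\sigma(X^*, X^{**})$), the scalar sequence $(x_n^*(x_n))$ converges to $0$. A map $T : X \to X^*$ (not assumed linear, homogeneous or continuous) is called a dual map if $\|T(x)\| = \|x\|$ and $T(x)(x) = \|x\|^2$ for all $x \in X$ (so $T(0) = 0$). $T$ is sequentially $w$-$w$ continuous at $0$ if for every sequence $(x_n)$ in $X$ converging weakly to $0$, the sequence $(T(x_n))$ converges to $T(0) = 0$ in the weak topology $\sigma(X^*, X^{**})$ of $X^*$. *)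

theory Defs
  imports "HOL-Analysis.Analysis"
begin

text \<open>
  A Banach space over the scalar field \<open>'k\<close> (used for real and complex scalars) is given by a type
  of class \<open>banach\<close> and a scalar multiplication compatible with its norm and with the real scalar
  multiplication of the class. For \<open>'k = real\<close> the last condition forces \<open>smul = scaleR\<close>.
\<close>

locale banach_space_over = vector_space smul
  for smul :: "'k::real_normed_field \<Rightarrow> 'x::banach \<Rightarrow> 'x" +
  assumes norm_smul: "norm (smul a x) = norm a * norm x"
    and smul_of_real: "smul (of_real r) x = r *\<^sub>R x"

lemma banach_space_over_scaleR: "banach_space_over (scaleR :: real \<Rightarrow> 'x::banach \<Rightarrow> 'x)"
  by unfold_locales (simp_all add: algebra_simps)

text \<open>
  A continuous \<open>'k\<close>-linear functional is a bounded real-linear map into \<open>'k\<close> that commutes with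
  \<open>'k\<close>-scalars, so the dual is a set of elements of the library type of bounded linear maps, whose
  norm is the operator norm. It is the whole type when \<open>smul = scaleR\<close>.
\<close>

definition dual_space :: "('k::real_normed_field \<Rightarrow> 'x::real_normed_vector \<Rightarrow> 'x) \<Rightarrow> ('x \<Rightarrow>\<^sub>L 'k) set"
  where "dual_space smul = {f. \<forall>a x. blinfun_apply f (smul a x) = a * blinfun_apply f x}"

lemma dual_space_scaleR: "dual_space (scaleR :: real \<Rightarrow> 'x::real_normed_vector \<Rightarrow> 'x) = UNIV"
  by (simp add: dual_space_def blinfun.scaleR_right)

text \<open>
  Continuous \<open>'k\<close>-linear functionals on the dual. Only the values on \<open>dual_space smul\<close> matter; here
  \<open>blinfun_mult_right a o\<^sub>L f\<close> is the functional \<open>x \<mapsto> a * f x\<close>.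
\<close>

definition bidual_space ::
    "('k::real_normed_field \<Rightarrow> 'x::real_normed_vector \<Rightarrow> 'x) \<Rightarrow> (('x \<Rightarrow>\<^sub>L 'k) \<Rightarrow> 'k) set"
  where "bidual_space smul = {\<phi>.
    (\<forall>f\<in>dual_space smul. \<forall>g\<in>dual_space smul. \<phi> (f + g) = \<phi> f + \<phi> g) \<and>
    (\<forall>a. \<forall>f\<in>dual_space smul. \<phi> (blinfun_mult_right a o\<^sub>L f) = a * \<phi> f) \<and>
    (\<exists>C. \<forall>f\<in>dual_space smul. norm (\<phi> f) \<le> C * norm f)}"

text \<open>The coarsest topology on \<open>S\<close> making all functions in \<open>F\<close> continuous.\<close>

definition initial_topology :: "'a set \<Rightarrow> ('a \<Rightarrow> 'b::topological_space) set \<Rightarrow> 'a topology"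
  where "initial_topology S F = topology_generated_by {S \<inter> f -` U | f U. f \<in> F \<and> open U}"

definition weak_topology :: "('k::real_normed_field \<Rightarrow> 'x::real_normed_vector \<Rightarrow> 'x) \<Rightarrow> 'x topology"
  where "weak_topology smul = initial_topology UNIV (blinfun_apply ` dual_space smul)"

definition dual_weak_topology ::
    "('k::real_normed_field \<Rightarrow> 'x::real_normed_vector \<Rightarrow> 'x) \<Rightarrow> ('x \<Rightarrow>\<^sub>L 'k) topology"
  where "dual_weak_topology smul = initial_topology (dual_space smul) (bidual_space smul)"

definition schur_property :: "('k::real_normed_field \<Rightarrow> 'x::real_normed_vector \<Rightarrow> 'x) \<Rightarrow> bool"
  where "schur_property smul \<longleftrightarrow>
    (\<forall>x :: nat \<Rightarrow> 'x. limitin (weak_topology smul) x 0 sequentially \<longrightarrow> (\<lambda>n. norm (x n)) \<longlonglongrightarrow> 0)"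

definition dunford_pettis_property ::
    "('k::real_normed_field \<Rightarrow> 'x::real_normed_vector \<Rightarrow> 'x) \<Rightarrow> bool"
  where "dunford_pettis_property smul \<longleftrightarrow>
    (\<forall>(x :: nat \<Rightarrow> 'x) (f :: nat \<Rightarrow> 'x \<Rightarrow>\<^sub>L 'k).
       limitin (weak_topology smul) x 0 sequentially \<longrightarrow>
       (\<forall>n. f n \<in> dual_space smul) \<longrightarrow>
       limitin (dual_weak_topology smul) f 0 sequentially \<longrightarrow>
       (\<lambda>n. blinfun_apply (f n) (x n)) \<longlonglongrightarrow> 0)"

definition dual_map ::
    "('k::real_normed_field \<Rightarrow> 'x::real_normed_vector \<Rightarrow> 'x) \<Rightarrow> ('x \<Rightarrow> 'x \<Rightarrow>\<^sub>L 'k) \<Rightarrow> bool"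
  where "dual_map smul T \<longleftrightarrow>
    (\<forall>x. T x \<in> dual_space smul \<and> norm (T x) = norm x \<and>
         blinfun_apply (T x) x = of_real ((norm x)\<^sup>2))"

definition seq_ww_continuous_at_0 ::
    "('k::real_normed_field \<Rightarrow> 'x::real_normed_vector \<Rightarrow> 'x) \<Rightarrow> ('x \<Rightarrow> 'x \<Rightarrow>\<^sub>L 'k) \<Rightarrow> bool"
  where "seq_ww_continuous_at_0 smul T \<longleftrightarrow>
    (\<forall>x :: nat \<Rightarrow> 'x. limitin (weak_topology smul) x 0 sequentially \<longrightarrow>
       limitin (dual_weak_topology smul) (\<lambda>n. T (x n)) (T 0) sequentially)"

lemma limitin_initial_topology:
  fixes x :: "'i \<Rightarrow> 'a" and F :: "('a \<Rightarrow> 'b::topological_space) set"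
  assumes "F \<noteq> {}" and "l \<in> S" and "\<And>n. x n \<in> S"
  shows "limitin (initial_topology S F) x l G \<longleftrightarrow> (\<forall>f\<in>F. ((\<lambda>n. f (x n)) \<longlongrightarrow> f l) G)"
proof
  assume L: "limitin (initial_topology S F) x l G"
  show "\<forall>f\<in>F. ((\<lambda>n. f (x n)) \<longlongrightarrow> f l) G"
  proof (intro ballI topological_tendstoI)
    fix f U assume "f \<in> F" "open U" "f l \<in> U"
    then have "openin (initial_topology S F) (S \<inter> f -` U)"
      unfolding initial_topology_def by (intro topology_generated_by_Basis) blast
    then have "\<forall>\<^sub>F n in G. x n \<in> S \<inter> f -` U"
      using L \<open>f l \<in> U\<close> \<open>l \<in> S\<close> unfolding limitin_def by blast
    then show "\<forall>\<^sub>F n in G. f (x n) \<in> U" by (rule eventually_mono) simp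
  qed
next
  assume R: "\<forall>f\<in>F. ((\<lambda>n. f (x n)) \<longlongrightarrow> f l) G"
  have top: "topspace (initial_topology S F) = S"
    using \<open>F \<noteq> {}\<close> unfolding initial_topology_def topology_generated_by_topspace
    by (auto intro: open_UNIV)
  have "\<forall>\<^sub>F n in G. x n \<in> W"
    if "generate_topology_on {S \<inter> f -` U | f U. f \<in> F \<and> open U} W" "l \<in> W" for W
    using that
  proof (induction rule: generate_topology_on.induct)
    case (Basis W)
    then obtain f U where W: "W = S \<inter> f -` U" "f \<in> F" "open U" by blast
    then have "\<forall>\<^sub>F n in G. f (x n) \<in> U"
      using R Basis.prems by (auto dest: topological_tendstoD)
    then show ?case using W assms(3) by (auto elim: eventually_mono)
  next
    case (Int a b)
    then show ?case by (simp add: eventually_conj)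
  next
    case (UN K)
    then obtain k where k: "k \<in> K" "l \<in> k" by blast
    then have "\<forall>\<^sub>F n in G. x n \<in> k" using UN by blast
    then show ?case by (rule eventually_mono) (use k in blast)
  qed simp
  then show "limitin (initial_topology S F) x l G"
    using top \<open>l \<in> S\<close> unfolding limitin_def
    by (auto simp: initial_topology_def openin_topology_generated_by_iff)
qed

lemma limitin_weak_topology:
  "limitin (weak_topology smul) x l G \<longleftrightarrow>
    (\<forall>f\<in>dual_space smul. ((\<lambda>n. blinfun_apply f (x n)) \<longlongrightarrow> blinfun_apply f l) G)"
proof -
  have "0 \<in> dual_space smul" by (simp add: dual_space_def)
  then have "blinfun_apply ` dual_space smul \<noteq> {}" by blast
  then show ?thesis unfolding weak_topology_def by (subst limitin_initial_topology) auto
qed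

lemma limitin_dual_weak_topology:
  assumes "l \<in> dual_space smul" and "\<And>n. f n \<in> dual_space smul"
  shows "limitin (dual_weak_topology smul) f l G \<longleftrightarrow>
    (\<forall>\<phi>\<in>bidual_space smul. ((\<lambda>n. \<phi> (f n)) \<longlongrightarrow> \<phi> l) G)"
proof -
  have "(\<lambda>_. 0) \<in> bidual_space smul"
    by (auto simp: bidual_space_def intro!: exI[of _ 0])
  then have "bidual_space smul \<noteq> {}" by blast
  then show ?thesis unfolding dual_weak_topology_def
    using assms by (intro limitin_initial_topology)
qed

end

theory Submission
  imports Defs
begin

text \<open>
  Everything follows from the identity \<open>T x x = \<parallel>x\<parallel>\<^sup>2\<close> of a dual map.

  If \<open>x\<^sub>n \<rightarrow> 0\<close> weakly and some dual map \<open>T\<close> is sequentially weak-weak continuous at \<open>0\<close>, then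
  \<open>T x\<^sub>n \<rightarrow> 0\<close> weakly in the dual, so the Dunford-Pettis property applied to \<open>x\<^sub>n\<close> and \<open>T x\<^sub>n\<close> says
  \<open>\<parallel>x\<^sub>n\<parallel>\<^sup>2 = T x\<^sub>n x\<^sub>n \<rightarrow> 0\<close>, which is the Schur property (\<open>schur_if_dual_map_continuous\<close>).

  Conversely, let the Schur property hold. A weakly null sequence is then norm null. Since
  \<open>\<parallel>T x\<^sub>n\<parallel> = \<parallel>x\<^sub>n\<parallel>\<close>, every dual map sends it to a norm null, hence weakly null, sequence
  (\<open>dual_map_continuous_if_schur\<close>). Moreover a weakly null sequence of functionals is bounded in norm
  by the uniform boundedness principle, so its values at a norm null sequence tend to \<open>0\<close>
  (\<open>dunford_pettis_if_schur\<close>).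

  To pass from "every dual map" to "some dual map", dual maps must exist; this is the norming
  functional given by the Hahn-Banach theorem (\<open>exists_linear_below_sublinear\<close>), over the reals
  directly and over the complex numbers by complexifying a real functional.
\<close>

section \<open>The uniform boundedness principle\<close>

text \<open>
  The sets on which all operators are bounded by \<open>n\<close> are closed and cover the complete space, so by
  Baire one of them contains a ball; linearity moves the bound on that ball to the unit ball.
\<close>

lemma uniform_boundedness:
  fixes f :: "'i \<Rightarrow> 'a::banach \<Rightarrow>\<^sub>L 'b::real_normed_vector"
  assumes "\<And>x. \<exists>B. \<forall>i. norm (f i x) \<le> B"
  shows "\<exists>M. \<forall>i. norm (f i) \<le> M"
proof -
  define F where "F n = {x. \<forall>i. norm (f i x) \<le> real n}" for n :: nat
  have closed: "closed (F n)" for n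
    unfolding F_def by (intro closed_Collect_all closed_Collect_le continuous_intros)
  have cover: "\<Union> (range F) = UNIV"
  proof -
    have "\<exists>n. x \<in> F n" for x
    proof -
      obtain B where B: "\<And>i. norm (f i x) \<le> B" using assms by blast
      obtain n :: nat where "B \<le> real n" using real_arch_simple by blast
      then have "x \<in> F n" unfolding F_def using B order_trans by blast
      then show ?thesis ..
    qed
    then show ?thesis by blast
  qed
  have "\<exists>n. interior (F n) \<noteq> {}"
  proof (rule ccontr)
    assume "\<not> ?thesis"
    then have "Met_TC.mtopology interior_of \<Union> (range F) = {}"
      by (intro Met_TC.metric_Baire_category_alt) (auto simp: closed complete_UNIV)
    then show False by (simp add: cover)
  qed
  then obtain n a where "a \<in> interior (F n)" by blast
  then obtain r where r: "r > 0" "cball a r \<subseteq> F n"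
    using mem_interior_cball by blast
  have "norm (f i x) \<le> (2 * real n / r) * norm x" for i x
  proof (cases "x = 0")
    case False
    \<comment> \<open>\<open>x\<close> rescaled to length \<open>r\<close>, so that \<open>a + y\<close> stays in the ball and \<open>f i y\<close> is a difference of
      two values bounded by \<open>n\<close>\<close>
    define y where "y = (r / norm x) *\<^sub>R x"
    have "a \<in> cball a r" "a + y \<in> cball a r"
      using r False by (auto simp: y_def dist_norm)
    then have "norm (f i a) \<le> n" "norm (f i (a + y)) \<le> n"
      using r unfolding F_def by blast+
    moreover have "f i y = f i (a + y) - f i a" by (simp add: blinfun.add_right)
    ultimately have "norm (f i y) \<le> 2 * real n"
      using norm_triangle_ineq4[of "f i (a + y)" "f i a"] by simp
    then show ?thesis using r False
      by (simp add: y_def blinfun.scaleR_right field_simps)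
  qed simp
  then have "norm (f i) \<le> 2 * real n / r" for i
    using r by (intro norm_blinfun_bound) auto
  then show ?thesis by blast
qed

section \<open>The Hahn-Banach theorem\<close>

text \<open>
  Homogeneity is stated as an inequality because inequalities pass to infima; applied to \<open>1/t\<close> and
  \<open>t x\<close>, the inequality yields the usual equality (\<open>sublinear_scale\<close>).
\<close>

definition sublinear :: "('a::real_vector \<Rightarrow> real) \<Rightarrow> bool" where
  "sublinear p \<longleftrightarrow> (\<forall>x y. p (x + y) \<le> p x + p y) \<and> (\<forall>t>0. \<forall>x. p (t *\<^sub>R x) \<le> t * p x)"

lemma sublinear_add: "sublinear p \<Longrightarrow> p (x + y) \<le> p x + p y"
  and sublinear_scale_le: "sublinear p \<Longrightarrow> t > 0 \<Longrightarrow> p (t *\<^sub>R x) \<le> t * p x"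
  by (auto simp: sublinear_def)

lemma sublinear_zero: assumes "sublinear p" shows "p 0 = 0"
  using sublinear_add[OF assms, of 0 0] sublinear_scale_le[OF assms, of "1/2" 0] by simp

lemma sublinear_scale:
  assumes "sublinear p" "t \<ge> 0" shows "p (t *\<^sub>R x) = t * p x"
proof (cases "t = 0")
  case False
  then have "p x \<le> (1 / t) * p (t *\<^sub>R x)"
    using sublinear_scale_le[OF assms(1), of "1 / t" "t *\<^sub>R x"] assms(2) by simp
  then have "t * p x \<le> p (t *\<^sub>R x)"
    using False assms(2) by (simp add: field_simps)
  then show ?thesis using sublinear_scale_le[OF assms(1), of t x] False assms(2) by simp
qed (simp add: sublinear_zero[OF assms(1)])

lemma sublinear_ge_minus: assumes "sublinear p" shows "- p (- x) \<le> p x"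
  using sublinear_add[OF assms, of x "- x"] sublinear_zero[OF assms] by simp

lemma sublinear_norm: "sublinear (norm :: 'a::real_normed_vector \<Rightarrow> real)"
  by (simp add: sublinear_def norm_triangle_ineq)

text \<open>
  Any linear functional below \<open>p\<close> that agrees with \<open>p\<close> at \<open>v\<close> lies below
  \<open>q x = inf {p (x + t v) - t p v | t \<ge> 0}\<close>, and conversely \<open>q (-v) \<le> - p v\<close> forces a linear
  functional below \<open>q\<close> to agree with \<open>p\<close> at \<open>v\<close>. Passing to \<open>q\<close> thus encodes the interpolation
  condition at \<open>v\<close> in the sublinear bound.
\<close>

lemma sublinear_tighten:
  assumes p: "sublinear p"
  shows "\<exists>q. sublinear q \<and> q \<le> p \<and> q (- v) \<le> - p v"
proof -
  define h where "h x t = p (x + t *\<^sub>R v) - t * p v" for x and t :: real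
  define q where "q x = (INF t\<in>{0..}. h x t)" for x
  have low: "- p (- x) \<le> h x t" if "t \<ge> 0" for x t
    using sublinear_add[OF p, of "x + t *\<^sub>R v" "- x"] sublinear_scale[OF p that, of v]
    by (simp add: h_def)
  have bdd: "bdd_below (h x ` {0..})" for x
    using low by (auto intro!: bdd_belowI2)
  have q_le: "q x \<le> h x t" if "t \<ge> 0" for x t
    unfolding q_def using that by (intro cINF_lower bdd) auto
  have q_ge: "c \<le> q x" if "\<And>t. t \<ge> 0 \<Longrightarrow> c \<le> h x t" for c x
    unfolding q_def by (intro cINF_greatest) (auto intro: that)
  have add: "q (x + y) \<le> q x + q y" for x y
  proof -
    have "q (x + y) - h x s \<le> h y t" if "s \<ge> 0" "t \<ge> 0" for s t
    proof -
      have "p (x + y + (s + t) *\<^sub>R v) \<le> p (x + s *\<^sub>R v) + p (y + t *\<^sub>R v)"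
        using sublinear_add[OF p, of "x + s *\<^sub>R v" "y + t *\<^sub>R v"] by (simp add: algebra_simps)
      then have "h (x + y) (s + t) \<le> h x s + h y t"
        by (simp add: h_def algebra_simps)
      then show ?thesis using q_le[of "s + t" "x + y"] that by simp
    qed
    then have "q (x + y) - h x s \<le> q y" if "s \<ge> 0" for s using that by (intro q_ge)
    then have "q (x + y) - q y \<le> q x" by (intro q_ge) (simp add: algebra_simps)
    then show ?thesis by simp
  qed
  have scale: "q (c *\<^sub>R x) \<le> c * q x" if c: "c > 0" for c x
  proof -
    have "q (c *\<^sub>R x) / c \<le> h x t" if "t \<ge> 0" for t
    proof -
      have "p (c *\<^sub>R x + (c * t) *\<^sub>R v) = c * p (x + t *\<^sub>R v)"
        using sublinear_scale[OF p, of c "x + t *\<^sub>R v"] c by (simp add: scaleR_add_right)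
      then have "h (c *\<^sub>R x) (c * t) = c * h x t" by (simp add: h_def algebra_simps)
      then show ?thesis using q_le[of "c * t" "c *\<^sub>R x"] c that by (simp add: field_simps)
    qed
    then have "q (c *\<^sub>R x) / c \<le> q x" by (rule q_ge)
    then show ?thesis using c by (simp add: field_simps)
  qed
  have "q \<le> p" using q_le[of 0] by (simp add: le_fun_def h_def)
  moreover have "q (- v) \<le> - p v"
    using q_le[of 1 "- v"] sublinear_zero[OF p] by (simp add: h_def)
  moreover have "sublinear q" using add scale by (simp add: sublinear_def)
  ultimately show ?thesis by blast
qed

text \<open>
  Zorn's lemma applies because the pointwise infimum of a chain is finite, by \<open>q x \<ge> - p (- x)\<close>, and
  again subadditive: of two members of the chain, the smaller one bounds both summands.
\<close>

lemma exists_minimal_sublinear: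
  assumes p: "sublinear p"
  shows "\<exists>m. sublinear m \<and> m \<le> p \<and> (\<forall>r. sublinear r \<and> r \<le> m \<longrightarrow> r = m)"
proof -
  define A where "A = {q. sublinear q \<and> q \<le> p}"
  have "\<exists>m\<in>A. \<forall>a\<in>A. a \<le> m \<longrightarrow> a = m"
  proof (rule predicate_Zorn)
    \<comment> \<open>the order is reversed, so that maximal elements are minimal functionals\<close>
    show "partial_order_on A (relation_of (\<lambda>q r. r \<le> q) A)"
      by (rule partial_order_on_relation_ofI) auto
    fix C assume "C \<in> Chains (relation_of (\<lambda>q r. r \<le> q) A)"
    then have C: "C \<subseteq> A" and chain: "\<And>q r. q \<in> C \<Longrightarrow> r \<in> C \<Longrightarrow> q \<le> r \<or> r \<le> q"
      unfolding Chains_def relation_of_def by blast+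
    show "\<exists>u\<in>A. \<forall>a\<in>C. u \<le> a"
    proof (cases "C = {}")
      case True
      then show ?thesis using p by (auto simp: A_def)
    next
      case False
      define u where "u x = (INF q\<in>C. q x)" for x
      have sub: "sublinear q" "q \<le> p" if "q \<in> C" for q
        using C that by (auto simp: A_def)
      have "- p (- x) \<le> q x" if "q \<in> C" for q x
        using sublinear_ge_minus[OF sub(1)[OF that], of x] le_funD[OF sub(2)[OF that], of "- x"]
        by simp
      then have bdd: "bdd_below ((\<lambda>q. q x) ` C)" for x
        by (auto intro!: bdd_belowI2)
      have u_le: "u x \<le> q x" if "q \<in> C" for q x
        unfolding u_def using that by (intro cINF_lower bdd)
      have u_ge: "c \<le> u x" if "\<And>q. q \<in> C \<Longrightarrow> c \<le> q x" for c x
        unfolding u_def using False by (intro cINF_greatest) (auto intro: that)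
      have "u (x + y) \<le> u x + u y" for x y
      proof -
        have "u (x + y) - q x \<le> r y" if qr: "q \<in> C" "r \<in> C" for q r
        proof -
          obtain m where m: "m \<in> C" "m \<le> q" "m \<le> r"
            using chain[OF qr] qr by blast
          have "u (x + y) \<le> m x + m y"
            using u_le[OF m(1)] sublinear_add[OF sub(1)[OF m(1)]] order_trans by blast
          then show ?thesis using le_funD[OF m(2), of x] le_funD[OF m(3), of y] by simp
        qed
        then have "u (x + y) - q x \<le> u y" if "q \<in> C" for q using that by (intro u_ge)
        then have "u (x + y) - u y \<le> u x" by (intro u_ge) (simp add: algebra_simps)
        then show ?thesis by simp
      qed
      moreover have "u (c *\<^sub>R x) \<le> c * u x" if c: "c > 0" for c x
      proof -
        have "u (c *\<^sub>R x) / c \<le> q x" if "q \<in> C" for q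
          using order_trans[OF u_le[OF that] sublinear_scale_le[OF sub(1)[OF that] c]] c
          by (simp add: field_simps)
        then have "u (c *\<^sub>R x) / c \<le> u x" by (rule u_ge)
        then show ?thesis using c by (simp add: field_simps)
      qed
      moreover have "u \<le> p"
        using False u_le sub(2) by (meson all_not_in_conv le_fun_def order_trans)
      ultimately have "u \<in> A" by (simp add: A_def sublinear_def)
      then show ?thesis using u_le by (auto simp: le_fun_def)
    qed
  qed
  then obtain m where m: "m \<in> A" "\<And>a. a \<in> A \<Longrightarrow> a \<le> m \<Longrightarrow> a = m" by blast
  have "r = m" if "sublinear r" "r \<le> m" for r
    using m that order_trans by (fastforce simp: A_def)
  with m(1) show ?thesis by (auto simp: A_def)
qed

text \<open>
  Tightening a minimal sublinear functional at \<open>w\<close> cannot change it, so it is odd, and an odd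
  sublinear functional is linear.
\<close>

lemma minimal_sublinear_linear:
  assumes m: "sublinear m" and min: "\<And>r. sublinear r \<Longrightarrow> r \<le> m \<Longrightarrow> r = m"
  shows "linear m"
proof -
  have odd: "m (- w) = - m w" for w
  proof -
    obtain r where "sublinear r" "r \<le> m" "r (- w) \<le> - m w"
      using sublinear_tighten[OF m] by blast
    then have "m (- w) \<le> - m w" using min by blast
    then show ?thesis using sublinear_ge_minus[OF m, of "- w"] by simp
  qed
  have "m x + m y \<le> m (x + y)" for x y
    using sublinear_add[OF m, of "- x" "- y"] odd[of x] odd[of y] odd[of "x + y"] by simp
  then have add: "m (x + y) = m x + m y" for x y
    using sublinear_add[OF m, of x y] antisym by blast
  have "m (t *\<^sub>R x) = t * m x" for t x
  proof (cases "t \<ge> 0")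
    case False
    then show ?thesis
      using sublinear_scale[OF m, of "- t" x] odd[of "t *\<^sub>R x"] by simp
  qed (rule sublinear_scale[OF m])
  with add show ?thesis by (intro linearI) auto
qed

theorem exists_linear_below_sublinear:
  fixes p :: "'a::real_vector \<Rightarrow> real"
  assumes p: "sublinear p"
  shows "\<exists>g. linear g \<and> (\<forall>x. g x \<le> p x) \<and> g v = p v"
proof -
  obtain q where q: "sublinear q" "q \<le> p" "q (- v) \<le> - p v"
    using sublinear_tighten[OF p] by blast
  obtain m where m: "sublinear m" "m \<le> q" "\<And>r. sublinear r \<Longrightarrow> r \<le> m \<Longrightarrow> r = m"
    using exists_minimal_sublinear[OF q(1)] by blast
  have lin: "linear m" using minimal_sublinear_linear m by blast
  have le: "m x \<le> p x" for x
    using m(2) q(2) by (meson le_funD order_trans)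
  have "- m v \<le> - p v"
    using le_funD[OF m(2), of "- v"] q(3) linear_neg[OF lin, of v] by simp
  with le[of v] have "m v = p v" by simp
  with lin le show ?thesis by blast
qed

section \<open>Norming functionals and dual maps\<close>

lemma dual_spaceI:
  assumes "bounded_linear g" "\<And>a x. g (smul a x) = a * g x"
  shows "Blinfun g \<in> dual_space smul"
  using assms by (simp add: dual_space_def bounded_linear_Blinfun_apply)

lemma norming_functional_real:
  fixes smul :: "real \<Rightarrow> 'x::banach \<Rightarrow> 'x"
  assumes "banach_space_over smul"
  shows "\<exists>f\<in>dual_space smul. norm f \<le> 1 \<and> blinfun_apply f v = of_real (norm v)"
proof -
  interpret banach_space_over smul by fact
  obtain g where g: "linear g" "\<And>x. g x \<le> norm x" "g v = norm v"
    using exists_linear_below_sublinear[OF sublinear_norm] by blast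
  have abs: "norm (g x) \<le> 1 * norm x" for x
    using g(2)[of x] g(2)[of "- x"] linear_neg[OF g(1), of x] by simp
  then have bl: "bounded_linear g"
    using g(1) by (intro bounded_linear_intro[where K = 1]) (auto simp: linear_add linear_scale)
  have "smul a x = a *\<^sub>R x" for a x using smul_of_real[of a x] by simp
  then have "Blinfun g \<in> dual_space smul"
    using bl g(1) by (intro dual_spaceI) (auto simp: linear_scale)
  moreover have "norm (Blinfun g) \<le> 1"
    using abs by (intro norm_blinfun_bound) (auto simp: bounded_linear_Blinfun_apply[OF bl])
  ultimately show ?thesis
    using g(3) by (intro bexI[of _ "Blinfun g"]) (auto simp: bounded_linear_Blinfun_apply[OF bl])
qed

text \<open>
  A real functional \<open>g\<close> is the real part of the complex-linear \<open>f x = g x - \<i> g (\<i> x)\<close>. The bound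
  by the norm survives because \<open>f x\<close> can be rotated to a nonnegative real number, where \<open>f = g\<close>; and
  \<open>Re (f v) = \<parallel>v\<parallel> \<ge> |f v|\<close> leaves no room for an imaginary part at \<open>v\<close>.
\<close>

lemma norming_functional_complex:
  fixes smul :: "complex \<Rightarrow> 'x::banach \<Rightarrow> 'x"
  assumes "banach_space_over smul"
  shows "\<exists>f\<in>dual_space smul. norm f \<le> 1 \<and> blinfun_apply f v = of_real (norm v)"
proof -
  interpret banach_space_over smul by fact
  obtain g where g: "linear g" "\<And>x. g x \<le> norm x" "g v = norm v"
    using exists_linear_below_sublinear[OF sublinear_norm] by blast
  define f where "f x = Complex (g x) (- g (smul \<i> x))" for x
  have add: "f (x + y) = f x + f y" for x y
    by (simp add: f_def scale_right_distrib linear_add[OF g(1)] complex_eq_iff)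
  have split: "smul a x = Re a *\<^sub>R x + Im a *\<^sub>R smul \<i> x" for a x
  proof -
    have "smul a x = smul (of_real (Re a) + of_real (Im a) * \<i>) x"
      using complex_eq[of a] by (simp only: mult.commute)
    also have "\<dots> = Re a *\<^sub>R x + Im a *\<^sub>R smul \<i> x"
      by (simp only: scale_left_distrib scale_scale[symmetric] smul_of_real)
    finally show ?thesis .
  qed
  have hom: "f (smul a x) = a * f x" for a x
  proof -
    have "smul \<i> (smul a x) = Re a *\<^sub>R smul \<i> x + (- Im a) *\<^sub>R x"
      using split[of "\<i> * a" x] by (simp only: scale_scale) simp
    then have "g (smul \<i> (smul a x)) = Re a * g (smul \<i> x) - Im a * g x"
      by (simp only: linear_add[OF g(1)] linear_scale[OF g(1)]) simp
    moreover have "g (smul a x) = Re a * g x + Im a * g (smul \<i> x)"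
      by (subst split) (simp only: linear_add[OF g(1)] linear_scale[OF g(1)] real_scaleR_def)
    ultimately show ?thesis by (simp add: f_def complex_eq_iff del: scale_scale)
  qed
  have bound: "norm (f x) \<le> 1 * norm x" for x
  proof -
    define a where "a = cnj (sgn (f x))"
    have "cnj (sgn (f x)) * f x = of_real (norm (f x))"
    proof (cases "f x = 0")
      case False
      have "cnj (sgn (f x)) * f x = (f x * cnj (f x)) / of_real (norm (f x))"
        by (simp add: sgn_eq mult.commute)
      also have "\<dots> = of_real (norm (f x))"
        using False by (simp only: complex_norm_square[symmetric]) (simp add: power2_eq_square)
      finally show ?thesis .
    qed simp
    then have "f (smul a x) = of_real (norm (f x))" by (simp only: hom a_def)
    then have "norm (f x) = g (smul a x)" by (simp add: f_def complex_eq_iff)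
    also have "\<dots> \<le> norm a * norm x" using g(2) norm_smul by metis
    also have "\<dots> \<le> 1 * norm x"
      by (intro mult_right_mono) (auto simp: a_def norm_sgn)
    finally show ?thesis .
  qed
  have real_hom: "f (r *\<^sub>R x) = r *\<^sub>R f x" for r x
    using hom[of "of_real r" x] by (simp add: smul_of_real scaleR_conv_of_real)
  have bl: "bounded_linear f"
    using add real_hom bound by (intro bounded_linear_intro[where K = 1]) auto
  have "f v = of_real (norm v)"
  proof -
    have "Re (f v) = norm v" using g(3) by (simp add: f_def)
    moreover from this have "norm (f v) = Re (f v)"
      using bound[of v] complex_Re_le_cmod[of "f v"] by simp
    then have "Im (f v) = 0" using cmod_power2[of "f v"] by simp
    ultimately show ?thesis by (simp add: complex_eq_iff)
  qed
  moreover have "Blinfun f \<in> dual_space smul" using bl hom by (rule dual_spaceI)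
  moreover have "norm (Blinfun f) \<le> 1"
    using bound by (intro norm_blinfun_bound) (auto simp: bounded_linear_Blinfun_apply[OF bl])
  ultimately show ?thesis
    by (intro bexI[of _ "Blinfun f"]) (auto simp: bounded_linear_Blinfun_apply[OF bl])
qed

lemma dual_map_exists:
  fixes smul :: "'k::real_normed_field \<Rightarrow> 'x::banach \<Rightarrow> 'x"
  assumes "\<And>v. \<exists>f\<in>dual_space smul. norm f \<le> 1 \<and> blinfun_apply f v = of_real (norm v)"
  shows "\<exists>T. dual_map smul T"
proof -
  obtain f where f: "\<And>v. f v \<in> dual_space smul" "\<And>v. norm (f v) \<le> 1"
    "\<And>v. blinfun_apply (f v) v = of_real (norm v)"
    using assms by metis
  define T where "T v = norm v *\<^sub>R f v" for v
  have "dual_map smul T"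
    unfolding dual_map_def T_def
  proof (intro allI conjI)
    fix v
    show "norm v *\<^sub>R f v \<in> dual_space smul"
      using f(1)[of v] by (simp add: dual_space_def blinfun.scaleR_left)
    show "blinfun_apply (norm v *\<^sub>R f v) v = of_real ((norm v)\<^sup>2)"
      by (simp add: blinfun.scaleR_left f(3) scaleR_conv_of_real power2_eq_square)
    have "norm v \<le> norm (f v) * norm v"
      using norm_blinfun[of "f v" v] by (simp add: f(3))
    moreover have "norm (f v) * norm v \<le> 1 * norm v"
      using f(2) by (intro mult_right_mono) auto
    ultimately show "norm (norm v *\<^sub>R f v) = norm v" by (simp add: mult.commute)
  qed
  then show ?thesis by blast
qed

section \<open>The Schur property in terms of dual maps\<close>

lemma zero_in_dual_space: "0 \<in> dual_space smul"
  by (simp add: dual_space_def)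

lemma evaluation_in_bidual_space: "(\<lambda>f. blinfun_apply f x) \<in> bidual_space smul"
proof -
  have "norm (blinfun_apply f x) \<le> norm x * norm f" for f :: "'a \<Rightarrow>\<^sub>L 'b"
    using norm_blinfun[of f x] by (simp add: mult.commute)
  then show ?thesis by (auto simp: bidual_space_def blinfun.add_left)
qed

lemma dual_map_zero: "dual_map smul T \<Longrightarrow> T 0 = 0"
  by (metis dual_map_def norm_eq_zero norm_zero)

lemma norm_null_imp_dual_weakly_null:
  assumes f: "\<And>n. f n \<in> dual_space smul" and null: "(\<lambda>n. norm (f n)) \<longlonglongrightarrow> 0"
  shows "limitin (dual_weak_topology smul) f 0 sequentially"
proof (subst limitin_dual_weak_topology[OF zero_in_dual_space f], intro ballI)
  fix \<phi> assume "\<phi> \<in> bidual_space smul"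
  then obtain C where C: "\<And>g. g \<in> dual_space smul \<Longrightarrow> norm (\<phi> g) \<le> C * norm g"
    unfolding bidual_space_def by blast
  have "\<phi> 0 = 0" using C[OF zero_in_dual_space] by simp
  moreover have "(\<lambda>n. \<phi> (f n)) \<longlonglongrightarrow> 0"
  proof (rule Lim_null_comparison)
    show "\<forall>\<^sub>F n in sequentially. norm (\<phi> (f n)) \<le> C * norm (f n)" using C f by simp
    show "(\<lambda>n. C * norm (f n)) \<longlonglongrightarrow> 0" using tendsto_mult_right_zero[OF null] .
  qed
  ultimately show "(\<lambda>n. \<phi> (f n)) \<longlonglongrightarrow> \<phi> 0" by simp
qed

text \<open>
  Point evaluations belong to the bidual, so such a sequence is pointwise convergent and the
  uniform boundedness principle applies.
\<close>

lemma dual_weakly_null_imp_bounded: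
  fixes smul :: "'k::real_normed_field \<Rightarrow> 'x::banach \<Rightarrow> 'x"
  assumes f: "\<And>n. f n \<in> dual_space smul"
    and null: "limitin (dual_weak_topology smul) f 0 sequentially"
  shows "\<exists>M. \<forall>n. norm (f n) \<le> M"
proof (rule uniform_boundedness)
  fix x
  have "(\<lambda>n. blinfun_apply (f n) x) \<longlonglongrightarrow> blinfun_apply 0 x"
    using null evaluation_in_bidual_space[of x smul]
    unfolding limitin_dual_weak_topology[OF zero_in_dual_space f] by (rule bspec)
  then have "Bseq (\<lambda>n. blinfun_apply (f n) x)" using convergentI convergent_imp_Bseq by blast
  then show "\<exists>B. \<forall>n. norm (blinfun_apply (f n) x) \<le> B" by (auto simp: Bseq_def)
qed

lemma dunford_pettis_if_schur:
  fixes smul :: "'k::real_normed_field \<Rightarrow> 'x::banach \<Rightarrow> 'x"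
  assumes "schur_property smul"
  shows "dunford_pettis_property smul"
  unfolding dunford_pettis_property_def
proof (intro allI impI)
  fix x :: "nat \<Rightarrow> 'x" and f :: "nat \<Rightarrow> 'x \<Rightarrow>\<^sub>L 'k"
  assume x: "limitin (weak_topology smul) x 0 sequentially"
    and f: "\<forall>n. f n \<in> dual_space smul" "limitin (dual_weak_topology smul) f 0 sequentially"
  obtain M where M: "\<And>n. norm (f n) \<le> M" using dual_weakly_null_imp_bounded f by blast
  have x0: "(\<lambda>n. norm (x n)) \<longlonglongrightarrow> 0" using assms x by (simp add: schur_property_def)
  show "(\<lambda>n. blinfun_apply (f n) (x n)) \<longlonglongrightarrow> 0"
  proof (rule Lim_null_comparison)
    have "norm (blinfun_apply (f n) (x n)) \<le> M * norm (x n)" for n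
      using norm_blinfun[of "f n" "x n"] mult_right_mono[OF M[of n] norm_ge_zero[of "x n"]]
      by (rule order_trans)
    then show "\<forall>\<^sub>F n in sequentially. norm (blinfun_apply (f n) (x n)) \<le> M * norm (x n)" by simp
    show "(\<lambda>n. M * norm (x n)) \<longlonglongrightarrow> 0" using tendsto_mult_right_zero[OF x0] .
  qed
qed

lemma dual_map_continuous_if_schur:
  assumes "schur_property smul" and T: "dual_map smul T"
  shows "seq_ww_continuous_at_0 smul T"
  unfolding seq_ww_continuous_at_0_def dual_map_zero[OF T]
  using assms by (auto simp: schur_property_def dual_map_def intro: norm_null_imp_dual_weakly_null)

lemma schur_if_dual_map_continuous:
  assumes dp: "dunford_pettis_property smul" and T: "dual_map smul T"
    and cont: "seq_ww_continuous_at_0 smul T"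
  shows "schur_property smul"
  unfolding schur_property_def
proof (intro allI impI)
  fix x assume x: "limitin (weak_topology smul) x 0 sequentially"
  have "limitin (dual_weak_topology smul) (\<lambda>n. T (x n)) 0 sequentially"
    using cont x dual_map_zero[OF T] by (simp add: seq_ww_continuous_at_0_def)
  moreover have "\<forall>n. T (x n) \<in> dual_space smul" using T by (simp add: dual_map_def)
  ultimately have "(\<lambda>n. blinfun_apply (T (x n)) (x n)) \<longlonglongrightarrow> 0"
    using dp x unfolding dunford_pettis_property_def by simp
  then have "(\<lambda>n. norm (blinfun_apply (T (x n)) (x n))) \<longlonglongrightarrow> 0" by (rule tendsto_norm_zero)
  then have "(\<lambda>n. (norm (x n))\<^sup>2) \<longlonglongrightarrow> 0" using T by (simp add: dual_map_def norm_power)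
  then have "(\<lambda>n. sqrt ((norm (x n))\<^sup>2)) \<longlonglongrightarrow> sqrt 0" by (rule tendsto_real_sqrt)
  then show "(\<lambda>n. norm (x n)) \<longlonglongrightarrow> 0" by simp
qed

lemma schur_iff_dual_maps_continuous:
  fixes smul :: "'k::real_normed_field \<Rightarrow> 'x::banach \<Rightarrow> 'x"
  assumes "\<exists>T. dual_map smul T"
  shows "(schur_property smul \<longleftrightarrow> dunford_pettis_property smul \<and>
            (\<forall>T. dual_map smul T \<longrightarrow> seq_ww_continuous_at_0 smul T)) \<and>
         (schur_property smul \<longleftrightarrow> dunford_pettis_property smul \<and>
            (\<exists>T. dual_map smul T \<and> seq_ww_continuous_at_0 smul T))"
  using assms dunford_pettis_if_schur dual_map_continuous_if_schur schur_if_dual_map_continuous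
  by blast

theorem theorem4p1:
  fixes smulR :: "real \<Rightarrow> 'r::banach \<Rightarrow> 'r"
    and smulC :: "complex \<Rightarrow> 'c::banach \<Rightarrow> 'c"
  shows
    "(banach_space_over smulR \<longrightarrow>
       (schur_property smulR \<longleftrightarrow>
          dunford_pettis_property smulR \<and>
          (\<forall>T. dual_map smulR T \<longrightarrow> seq_ww_continuous_at_0 smulR T)) \<and>
       (schur_property smulR \<longleftrightarrow>
          dunford_pettis_property smulR \<and>
          (\<exists>T. dual_map smulR T \<and> seq_ww_continuous_at_0 smulR T)))
     \<and>
     (banach_space_over smulC \<longrightarrow>
       (schur_property smulC \<longleftrightarrow>
          dunford_pettis_property smulC \<and>
          (\<forall>T. dual_map smulC T \<longrightarrow> seq_ww_continuous_at_0 smulC T)) \<and>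
       (schur_property smulC \<longleftrightarrow>
          dunford_pettis_property smulC \<and>
          (\<exists>T. dual_map smulC T \<and> seq_ww_continuous_at_0 smulC T)))"
\<comment> \<open>the instantiation splits only between the two scalar fields\<close>
proof (intro conjI[of "_ \<longrightarrow> _" "_ \<longrightarrow> _"] impI)
  assume "banach_space_over smulR"
  from schur_iff_dual_maps_continuous[OF dual_map_exists[OF norming_functional_real[OF this]]]
  show "(schur_property smulR \<longleftrightarrow> dunford_pettis_property smulR \<and>
          (\<forall>T. dual_map smulR T \<longrightarrow> seq_ww_continuous_at_0 smulR T)) \<and>
       (schur_property smulR \<longleftrightarrow> dunford_pettis_property smulR \<and>
          (\<exists>T. dual_map smulR T \<and> seq_ww_continuous_at_0 smulR T))" .
next
  assume "banach_space_over smulC"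
  from schur_iff_dual_maps_continuous[OF dual_map_exists[OF norming_functional_complex[OF this]]]
  show "(schur_property smulC \<longleftrightarrow> dunford_pettis_property smulC \<and>
          (\<forall>T. dual_map smulC T \<longrightarrow> seq_ww_continuous_at_0 smulC T)) \<and>
       (schur_property smulC \<longleftrightarrow> dunford_pettis_property smulC \<and>
          (\<exists>T. dual_map smulC T \<and> seq_ww_continuous_at_0 smulC T))" .
qed

end
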